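(* Let $\mu,\nu$ be p-Borel measures on a non-degenerate interval $I\subset\mathbb{R}$ such that $\mathcal{M}^{\mu}=\mathcal{M}^{\nu}$ (that is, $\mathrm{Dom}(\mathcal{M}^{\mu})=\mathrm{Dom}(\mathcal{M}^{\nu})$ and $\mathcal{M}^{\mu}(H)=\mathcal{M}^{\nu}(H)$ for every $H$ in this common domain). Then there is $c\in\mathbb{R}$, $c>0$, such that $\nu=c\mu$.
   Context: A p-Borel measure on an interval $I\subset\mathbb{R}$ is a Borel measure $\mu$ on $I$ such that $\mu(H)<+\infty$ for every bounded measurable $H\subset I$ and $\mu(J)>0$ for every non-degenerate subinterval $J\subset I$. $\mathrm{Dom}(\mathcal{M}^{\mu})$ is the family of bounded $\mu$-measurable sets $H\subset I$ with $0<\mu(H)<+\infty$ ($\mu$-measurable means measurable with respect to the completion of $\mu$), and $\mathcal{M}^{\mu}(H)=\frac{\int_H x\,d\mu}{\mu(H)}$ for such $H$. *)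

theory Defs
  imports "HOL-Analysis.Analysis"
begin

definition nondegenerate_interval :: "real set \<Rightarrow> bool" where
  "nondegenerate_interval J \<longleftrightarrow> is_interval J \<and> (\<exists>a\<in>J. \<exists>b\<in>J. a < b)"

text \<open>
  A Borel measure on \<open>I\<close> is a measure on the Borel sigma-algebra of the subspace \<open>I\<close>;
  the condition on \<open>sets \<mu>\<close> also forces \<open>space \<mu> = I\<close>.
\<close>

definition p_Borel_measure :: "real set \<Rightarrow> real measure \<Rightarrow> bool" where
  "p_Borel_measure I \<mu> \<longleftrightarrow>
     sets \<mu> = sets (restrict_space borel I) \<and>
     (\<forall>H\<in>sets \<mu>. bounded H \<longrightarrow> emeasure \<mu> H < \<infinity>) \<and>
     (\<forall>J. J \<subseteq> I \<longrightarrow> nondegenerate_interval J \<longrightarrow> 0 < emeasure \<mu> J)"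

definition mean_dom :: "real measure \<Rightarrow> real set set" where
  "mean_dom \<mu> = {H \<in> sets (completion \<mu>). bounded H \<and>
     0 < emeasure (completion \<mu>) H \<and> emeasure (completion \<mu>) H < \<infinity>}"

text \<open>
  The mean is only meaningful on \<open>mean_dom \<mu>\<close>, where \<open>x\<close> is bounded on a set of finite
  measure, so that the Bochner integral takes its proper value.
\<close>

definition mean :: "real measure \<Rightarrow> real set \<Rightarrow> real" where
  "mean \<mu> H = (LINT x:H|completion \<mu>. x) / measure (completion \<mu>) H"

end

theory Submission
  imports Defs
begin

text \<open>
  The mean of a disjoint union \<open>A \<union> B\<close> is the average of the means of \<open>A\<close> and \<open>B\<close>, weighted by
  the measures of \<open>A\<close> and \<open>B\<close>. If those two means differ, the average determines the ratio of the
  weights, so two measures with the same mean give \<open>A\<close> and \<open>B\<close> measures in the same proportion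
  (\<open>equal_ratio\<close>).

  Cut \<open>I\<close> at an interior point \<open>t\<close>. Sets of positive measure to the left of \<open>t\<close> have mean at most
  \<open>t\<close>, those to the right have mean greater than \<open>t\<close> (\<open>mean_le\<close>, \<open>mean_gt\<close>). Hence \<open>\<nu> / \<mu>\<close> takes
  the same value on every left set as on every right set. Both sides contain an interval, which has
  positive measure, so a single constant \<open>c\<close> serves both sides. A bounded set is the union of its
  left and its right part, and an arbitrary Borel set is an increasing union of bounded ones.
\<close>

lemma p_Borel_measure_id_measurable:
  assumes "p_Borel_measure I M"
  shows "(\<lambda>x. x) \<in> borel_measurable M"
proof -
  have "(\<lambda>x::real. x) \<in> borel_measurable (restrict_space borel I)"
    by (intro measurable_restrict_space1) simp
  then show ?thesis
    using assms by (simp add: p_Borel_measure_def cong: measurable_cong_sets)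
qed

lemma p_Borel_measure_fmeasurable:
  assumes "p_Borel_measure I M" "H \<in> sets M" "bounded H"
  shows "H \<in> fmeasurable M"
  using assms by (auto simp: p_Borel_measure_def fmeasurable_def)

lemma p_Borel_measure_Int_borel:
  assumes "p_Borel_measure I M" "H \<in> sets M" "S \<in> sets borel"
  shows "H \<inter> S \<in> sets M"
proof -
  have "space M = I"
    using assms(1) sets_eq_imp_space_eq[of M "restrict_space borel I"]
    by (simp add: p_Borel_measure_def space_restrict_space)
  then have "H \<subseteq> I"
    using sets.sets_into_space[OF assms(2)] by simp
  have "S \<inter> I \<in> sets M"
    using assms(1,3) by (auto simp: p_Borel_measure_def sets_restrict_space)
  then have "H \<inter> (S \<inter> I) \<in> sets M"
    using assms(2) by blast
  moreover have "H \<inter> (S \<inter> I) = H \<inter> S"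
    using \<open>H \<subseteq> I\<close> by blast
  ultimately show ?thesis
    by simp
qed

lemma p_Borel_measure_interval_pos:
  assumes "p_Borel_measure I M" "J \<in> sets borel" "J \<subseteq> I" "nondegenerate_interval J" "bounded J"
  shows "J \<in> sets M" "measure M J > 0"
proof -
  show J: "J \<in> sets M"
    using assms(1-3) by (auto simp: p_Borel_measure_def sets_restrict_space)
  have "0 < emeasure M J"
    using assms by (auto simp: p_Borel_measure_def)
  then show "measure M J > 0"
    using p_Borel_measure_fmeasurable[OF assms(1) J assms(5)]
    by (simp add: emeasure_eq_measure2)
qed

lemma mem_mean_dom_iff:
  assumes "p_Borel_measure I M" "H \<in> sets M" "bounded H"
  shows "H \<in> mean_dom M \<longleftrightarrow> measure M H > 0"
  using assms p_Borel_measure_fmeasurable[OF assms]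
  by (simp add: mean_dom_def emeasure_eq_measure2)

lemma mean_eq_integral:
  assumes "p_Borel_measure I M" "H \<in> sets M"
  shows "mean M H = (LINT x:H|M. x) / measure M H"
proof -
  have "(\<lambda>x. indicat_real H x *\<^sub>R x) \<in> borel_measurable M"
    using p_Borel_measure_id_measurable[OF assms(1)] assms(2) by measurable
  then show ?thesis
    using assms(2)
    by (simp add: mean_def set_lebesgue_integral_def integral_completion)
qed

lemma set_integrable_id_bounded:
  fixes M :: "real measure"
  assumes "(\<lambda>x. x) \<in> borel_measurable M" "H \<in> fmeasurable M" "bounded H"
  shows "set_integrable M H (\<lambda>x. x)"
proof -
  obtain B where "\<And>x. x \<in> H \<Longrightarrow> norm x \<le> B"
    using assms(3) by (auto simp: bounded_iff)
  then show ?thesis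
    unfolding set_integrable_def
    using assms(1,2) by (intro integrableI_bounded_set_indicator[where B = B])
      (auto simp: fmeasurable_def)
qed

lemma set_integrable_const_fmeasurable:
  "H \<in> fmeasurable M \<Longrightarrow> set_integrable M H (\<lambda>x. c::real)"
  by (auto simp: set_integrable_def fmeasurable_def)

lemma set_integral_const_fmeasurable:
  "H \<in> fmeasurable M \<Longrightarrow> (LINT x:H|M. c) = c * measure M H" for c :: real
  by (auto simp: set_lebesgue_integral_def fmeasurable_def)

lemma mean_le:
  assumes "p_Borel_measure I M" "H \<in> sets M" "bounded H" "measure M H > 0" "H \<subseteq> {..t}"
  shows "mean M H \<le> t"
proof -
  note fin = p_Borel_measure_fmeasurable[OF assms(1-3)]
  have "(LINT x:H|M. x) \<le> (LINT x:H|M. t)"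
    using assms(5) fin set_integrable_id_bounded[OF p_Borel_measure_id_measurable[OF assms(1)] fin assms(3)]
    by (intro set_integral_mono set_integrable_const_fmeasurable) auto
  then show ?thesis
    using assms(4)
    by (simp add: mean_eq_integral[OF assms(1,2)] set_integral_const_fmeasurable[OF fin] divide_le_eq)
qed

text \<open>
  The inequality is strict because \<open>x - t\<close> is positive on \<open>H\<close>, so its integral over \<open>H\<close> vanishes
  only if \<open>H\<close> is a null set.
\<close>

lemma mean_gt:
  assumes "p_Borel_measure I M" "H \<in> sets M" "bounded H" "measure M H > 0" "H \<subseteq> {t<..}"
  shows "mean M H > t"
proof -
  note fin = p_Borel_measure_fmeasurable[OF assms(1-3)]
  note int = set_integrable_id_bounded[OF p_Borel_measure_id_measurable[OF assms(1)] fin assms(3)]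
    set_integrable_const_fmeasurable[OF fin, of t]
  have int_diff: "integrable M (\<lambda>x. indicat_real H x * (x - t))"
    using set_integral_diff(1)[OF int] by (simp add: set_integrable_def)
  have nonneg: "AE x in M. 0 \<le> indicat_real H x * (x - t)"
    using assms(5) by (intro AE_I2) (auto simp: indicator_def less_imp_le)
  have "(\<integral>x. indicat_real H x * (x - t) \<partial>M) \<noteq> 0"
  proof
    assume "(\<integral>x. indicat_real H x * (x - t) \<partial>M) = 0"
    then have "AE x in M. indicat_real H x * (x - t) = 0"
      using integral_nonneg_eq_0_iff_AE[OF int_diff nonneg] by simp
    then have "AE x in M. x \<notin> H"
      using assms(5) by (elim eventually_mono) (auto simp: indicator_def)
    then have "H \<in> null_sets M"
      using AE_iff_null_sets[OF assms(2)] by simp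
    then show False
      using assms(4) by (simp add: measure_def null_setsD1)
  qed
  then have "0 < (\<integral>x. indicat_real H x * (x - t) \<partial>M)"
    using integral_nonneg_AE[OF nonneg] by simp
  also have "\<dots> = (LINT x:H|M. x) - t * measure M H"
    using set_integral_diff(2)[OF int]
    by (simp add: set_lebesgue_integral_def[of M H "\<lambda>x. x - t"] set_integral_const_fmeasurable[OF fin])
  finally show ?thesis
    using assms(4) by (simp add: mean_eq_integral[OF assms(1,2)] less_divide_eq)
qed

lemma mean_Un:
  assumes M: "p_Borel_measure I M"
    and A: "A \<in> sets M" "bounded A" "measure M A > 0"
    and B: "B \<in> sets M" "bounded B" "measure M B > 0"
    and disj: "A \<inter> B = {}"
  shows "mean M (A \<union> B) =
    (mean M A * measure M A + mean M B * measure M B) / (measure M A + measure M B)"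
proof -
  note id = p_Borel_measure_id_measurable[OF M]
  note fA = p_Borel_measure_fmeasurable[OF M A(1,2)]
  note fB = p_Borel_measure_fmeasurable[OF M B(1,2)]
  have "(LINT x:A \<union> B|M. x) = (LINT x:A|M. x) + (LINT x:B|M. x)"
    using disj set_integrable_id_bounded[OF id fA A(2)] set_integrable_id_bounded[OF id fB B(2)]
    by (rule set_integral_Un)
  moreover have "measure M (A \<union> B) = measure M A + measure M B"
    using measure_Un2[OF fA fB] disj by (simp add: Diff_triv Int_commute)
  ultimately show ?thesis
    using A B mean_eq_integral[OF M] by simp
qed

text \<open>
  Writing \<open>m\<^sub>A \<noteq> m\<^sub>B\<close> for the common means of \<open>A\<close> and \<open>B\<close>, equality of the two weighted averages
  becomes, after clearing denominators, \<open>(m\<^sub>A - m\<^sub>B) (\<nu>(A) \<mu>(B) - \<nu>(B) \<mu>(A)) = 0\<close>.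
\<close>

lemma equal_ratio:
  assumes \<mu>: "p_Borel_measure I \<mu>" and \<nu>: "p_Borel_measure I \<nu>"
    and dom: "mean_dom \<mu> = mean_dom \<nu>"
    and mean: "\<forall>H\<in>mean_dom \<mu>. mean \<mu> H = mean \<nu> H"
    and A: "A \<in> sets \<mu>" "bounded A" "measure \<mu> A > 0"
    and B: "B \<in> sets \<mu>" "bounded B" "measure \<mu> B > 0"
    and disj: "A \<inter> B = {}"
    and neq: "mean \<mu> A \<noteq> mean \<mu> B"
  shows "measure \<nu> A / measure \<mu> A = measure \<nu> B / measure \<mu> B"
proof -
  have sets: "sets \<nu> = sets \<mu>"
    using \<mu> \<nu> by (simp add: p_Borel_measure_def)
  have memA: "A \<in> mean_dom \<mu>" and memB: "B \<in> mean_dom \<mu>"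
    using mem_mean_dom_iff[OF \<mu>] A B by auto
  have \<nu>pos: "measure \<nu> A > 0" "measure \<nu> B > 0"
    using mem_mean_dom_iff[OF \<nu>] A B memA memB dom sets by auto
  have "measure \<mu> (A \<union> B) = measure \<mu> A + measure \<mu> B"
    using measure_Un2[OF p_Borel_measure_fmeasurable[OF \<mu> A(1,2)] p_Borel_measure_fmeasurable[OF \<mu> B(1,2)]]
      disj by (simp add: Diff_triv Int_commute)
  then have "A \<union> B \<in> mean_dom \<mu>"
    using mem_mean_dom_iff[OF \<mu>, of "A \<union> B"] A B by simp
  then have "mean \<mu> (A \<union> B) = mean \<nu> (A \<union> B)"
    using mean by blast
  moreover have "mean \<nu> A = mean \<mu> A" "mean \<nu> B = mean \<mu> B"
    using mean memA memB by auto
  ultimately have "(mean \<mu> A * measure \<mu> A + mean \<mu> B * measure \<mu> B) * (measure \<nu> A + measure \<nu> B) =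
      (mean \<mu> A * measure \<nu> A + mean \<mu> B * measure \<nu> B) * (measure \<mu> A + measure \<mu> B)"
    using mean_Un[OF \<mu> A B disj] mean_Un[OF \<nu> _ A(2) \<nu>pos(1) _ B(2) \<nu>pos(2) disj]
      A B \<nu>pos sets by (simp add: frac_eq_eq)
  then have "(mean \<mu> A - mean \<mu> B) * (measure \<nu> A * measure \<mu> B - measure \<nu> B * measure \<mu> A) = 0"
    by (simp add: algebra_simps)
  then show ?thesis
    using neq A B by (simp add: frac_eq_eq)
qed

theorem theorem2p29:
  fixes I :: "real set" and \<mu> \<nu> :: "real measure"
  assumes "nondegenerate_interval I"
    and "p_Borel_measure I \<mu>"
    and "p_Borel_measure I \<nu>"
    and "mean_dom \<mu> = mean_dom \<nu>"
    and "\<forall>H\<in>mean_dom \<mu>. mean \<mu> H = mean \<nu> H"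
  shows "\<exists>c::real. c > 0 \<and> \<nu> = scale_measure (ennreal c) \<mu>"
proof -
  note \<mu> = assms(2) and \<nu> = assms(3)
  have sets: "sets \<nu> = sets \<mu>"
    using \<mu> \<nu> by (simp add: p_Borel_measure_def)
  obtain a b where "a \<in> I" "b \<in> I" "a < b" and I: "is_interval I"
    using assms(1) by (auto simp: nondegenerate_interval_def)
  define t where "t = (a + b) / 2"
  have t: "a < t" "t < b"
    using \<open>a < b\<close> by (auto simp: t_def)
  have "{a..b} \<subseteq> I"
    using mem_is_interval_1_I[OF I \<open>a \<in> I\<close> \<open>b \<in> I\<close>] by auto
  then have sub: "{a..t} \<subseteq> I" "{t<..b} \<subseteq> I"
    using t by auto
  have "nondegenerate_interval {a..t}"
    unfolding nondegenerate_interval_def using t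
    by (intro conjI is_interval_cc bexI[of _ a] bexI[of _ t]) auto
  note L = p_Borel_measure_interval_pos[OF _ _ sub(1) this bounded_closed_interval]
  have "nondegenerate_interval {t<..b}"
    unfolding nondegenerate_interval_def using t
    by (intro conjI is_interval_oc bexI[of _ "(t + b) / 2"] bexI[of _ b]) (auto simp: field_simps)
  note R = p_Borel_measure_interval_pos[OF _ _ sub(2) this bounded_Ioc]

  have ratio: "measure \<nu> A / measure \<mu> A = measure \<nu> B / measure \<mu> B"
    if "A \<in> sets \<mu>" "bounded A" "measure \<mu> A > 0" "A \<subseteq> {..t}"
      "B \<in> sets \<mu>" "bounded B" "measure \<mu> B > 0" "B \<subseteq> {t<..}" for A B
  proof (rule equal_ratio[OF assms(2-5) that(1-3) that(5-7)])
    show "A \<inter> B = {}"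
      using that(4,8) by force
    show "mean \<mu> A \<noteq> mean \<mu> B"
      using mean_le[OF \<mu> that(1-4)] mean_gt[OF \<mu> that(5-8)] by linarith
  qed

  define c where "c = measure \<nu> {t<..b} / measure \<mu> {t<..b}"
  have c: "c > 0"
    unfolding c_def using R(2)[OF \<mu>] R(2)[OF \<nu>] by simp
  have ratio_left: "measure \<nu> A / measure \<mu> A = c"
    if "A \<in> sets \<mu>" "bounded A" "measure \<mu> A > 0" "A \<subseteq> {..t}" for A
    unfolding c_def using R[OF \<mu>] by (intro ratio that) auto
  \<comment> \<open>The interval \<open>{a..t}\<close> carries the ratio \<open>c\<close> from the reference set \<open>{t<..b}\<close> back to every
    set on its own side.\<close>
  have ratio_right: "measure \<nu> B / measure \<mu> B = c"
    if "B \<in> sets \<mu>" "bounded B" "measure \<mu> B > 0" "B \<subseteq> {t<..}" for B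
  proof -
    have "measure \<nu> {a..t} / measure \<mu> {a..t} = measure \<nu> B / measure \<mu> B"
      using L[OF \<mu>] by (intro ratio that) auto
    then show ?thesis
      using ratio_left[of "{a..t}"] L[OF \<mu>] by simp
  qed

  have side: "measure \<nu> H = c * measure \<mu> H"
    if H: "H \<in> sets \<mu>" "bounded H" "H \<subseteq> {..t} \<or> H \<subseteq> {t<..}" for H
  proof (cases "measure \<mu> H > 0")
    case True
    then show ?thesis
      using ratio_left[OF H(1,2)] ratio_right[OF H(1,2)] H(3) by (auto simp: field_simps)
  next
    case False
    \<comment> \<open>A bounded Borel set has measure zero exactly when it lies outside the domain of the mean,
      so \<open>\<mu>\<close> and \<open>\<nu>\<close> have the same bounded Borel null sets.\<close>
    then have "\<not> measure \<nu> H > 0"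
      using mem_mean_dom_iff[OF \<mu> H(1,2)] mem_mean_dom_iff[OF \<nu> _ H(2)] H(1) sets assms(4) by simp
    then have "measure \<mu> H = 0" "measure \<nu> H = 0"
      using False by (simp_all add: not_less measure_le_0_iff)
    then show ?thesis
      by simp
  qed

  have bounded_case: "emeasure \<nu> H = emeasure (scale_measure (ennreal c) \<mu>) H"
    if H: "H \<in> sets \<mu>" "bounded H" for H
  proof -
    have split: "measure M H = measure M (H \<inter> {..t}) + measure M (H \<inter> {t<..})"
      if M: "p_Borel_measure I M" and HM: "H \<in> sets M" for M
    proof -
      have fin: "H \<inter> S \<in> fmeasurable M" if "S \<in> sets borel" for S
        using p_Borel_measure_fmeasurable[OF M p_Borel_measure_Int_borel[OF M HM that]] H(2)
        by (simp add: bounded_Int)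
      have "(H \<inter> {t<..}) - (H \<inter> {..t}) = H \<inter> {t<..}" "(H \<inter> {..t}) \<union> (H \<inter> {t<..}) = H"
        by auto
      then show ?thesis
        using measure_Un2[OF fin fin, of "{..t}" "{t<..}"] by simp
    qed
    have "measure \<nu> H = c * measure \<mu> H"
      using split[OF \<mu>] split[OF \<nu>] sets H side[of "H \<inter> {..t}"] side[of "H \<inter> {t<..}"]
        p_Borel_measure_Int_borel[OF \<mu> H(1)] by (simp add: bounded_Int distrib_left)
    then show ?thesis
      using p_Borel_measure_fmeasurable[OF \<mu> H] p_Borel_measure_fmeasurable[OF \<nu> _ H(2)] H(1) sets c
      by (simp add: emeasure_eq_measure2 ennreal_mult)
  qed

  have "\<nu> = scale_measure (ennreal c) \<mu>"
  proof (rule measure_eqI)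
    fix A assume "A \<in> sets \<nu>"
    define X where "X n = A \<inter> cball 0 (real n)" for n
    have A: "A \<in> sets \<mu>"
      using \<open>A \<in> sets \<nu>\<close> sets by simp
    have X: "X n \<in> sets \<mu>" "bounded (X n)" for n
      unfolding X_def using p_Borel_measure_Int_borel[OF \<mu> A] by (auto simp: bounded_Int)
    have "incseq X"
      by (force simp: X_def incseq_def)
    have "(\<Union>n. X n) = A"
      by (auto simp: X_def real_arch_simple)
    have "emeasure \<nu> A = (SUP n. emeasure \<nu> (X n))"
      using SUP_emeasure_incseq[of X \<nu>] X(1) sets \<open>incseq X\<close> \<open>(\<Union>n. X n) = A\<close>
      by (simp add: image_subset_iff)
    also have "\<dots> = (SUP n. emeasure (scale_measure (ennreal c) \<mu>) (X n))"
      using bounded_case X by simp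
    also have "\<dots> = emeasure (scale_measure (ennreal c) \<mu>) A"
      using SUP_emeasure_incseq[of X "scale_measure (ennreal c) \<mu>"] X(1) \<open>incseq X\<close> \<open>(\<Union>n. X n) = A\<close>
      by (simp add: image_subset_iff)
    finally show "emeasure \<nu> A = emeasure (scale_measure (ennreal c) \<mu>) A" .
  qed (simp add: sets)
  then show ?thesis
    using c by blast
qed

end
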